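(* Let $\tau>0$, let $f:\mathbb{R}\to\left]-\infty,+\infty\right]$ be a proper, closed, convex function, and let $\alpha<\beta$ be real numbers with $[\alpha,\beta]\subset \operatorname{dom} f$. Let $a_1,\dots,a_n\in L^\infty([0,\tau])$ and let $A:L^1([0,\tau])\to\mathbb{R}^n$ be the linear operator $$A x=\left(\int_0^\tau a_1(s)x(s)\,ds,\dots,\int_0^\tau a_n(s)x(s)\,ds\right).$$ Let $b\in\mathbb{R}^n$ and let $x\in \mathbf{S}_f$ satisfy $Ax=b$. Suppose there are $0\le \zeta_1<\zeta_2\le\tau$ and an interval $[\varepsilon_1,\varepsilon_2]\subset\left]\alpha,\beta\right[$ such that $x$ maps $[\zeta_1,\zeta_2]$ into $[\varepsilon_1,\varepsilon_2]$, and suppose that (the restrictions of) $a_1,\dots,a_n$ are linearly independent in $L^\infty([\zeta_1,\zeta_2])$ and bounded on $[\zeta_1,\zeta_2]$. Then $b\in\operatorname{core}\bigl(A(\operatorname{dom} I_f)\bigr)$.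
   Context: $\operatorname{dom} f=\{u\in\mathbb{R} : f(u)<\infty\}$. The entropy functional associated with $f$ is $I_f(x)=\int_0^\tau f(x(s))\,ds$ for $x\in L^1([0,\tau])$, and $\operatorname{dom} I_f=\{x\in L^1([0,\tau]) : \int_0^\tau f(x(s))\,ds<\infty\}$. All function spaces are with respect to Lebesgue measure. $\mathbf{S}_f=\{x\in L^p([0,\tau]) : x(s)\in[\alpha,\beta]\text{ for almost every } s\}$ (since its members are bounded and $[0,\tau]$ has finite measure, this set does not depend on $p\in[1,\infty]$). The core of a set $C\subset\mathbb{R}^n$, denoted $\operatorname{core} C$, is the set of points $c\in C$ such that for every direction $\eta\in\mathbb{R}^n$, $c+t\eta\in C$ for all sufficiently small $t>0$. *)

theory Defs
  imports "HOL-Analysis.Analysis"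
begin

text \<open>
  Elements of Lebesgue spaces on an interval are represented by functions \<open>real \<Rightarrow> real\<close> whose values
  outside the interval are irrelevant; every notion below depends only on the almost-everywhere
  class of a function on the interval.
\<close>

definition L1 :: "real \<Rightarrow> (real \<Rightarrow> real) set" where
  "L1 \<tau> = {x. integrable (lebesgue_on {0..\<tau>}) x}"

definition Linf :: "real set \<Rightarrow> (real \<Rightarrow> real) set" where
  "Linf S = {g \<in> borel_measurable (lebesgue_on S). \<exists>B. AE s in lebesgue_on S. \<bar>g s\<bar> \<le> B}"

text \<open>The zero vector of \<open>L\<^sup>\<infinity>(S)\<close> is the class of functions vanishing almost everywhere on \<open>S\<close>.\<close>

definition lin_indep_Linf :: "real set \<Rightarrow> ('n::finite \<Rightarrow> real \<Rightarrow> real) \<Rightarrow> bool" where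
  "lin_indep_Linf S a \<longleftrightarrow>
     (\<forall>c :: 'n \<Rightarrow> real. (AE s in lebesgue_on S. (\<Sum>i\<in>UNIV. c i * a i s) = 0) \<longrightarrow> (\<forall>i. c i = 0))"

definition dom_ereal :: "('a \<Rightarrow> ereal) \<Rightarrow> 'a set" where
  "dom_ereal f = {u. f u < \<infinity>}"

definition proper_fun :: "('a \<Rightarrow> ereal) \<Rightarrow> bool" where
  "proper_fun f \<longleftrightarrow> (\<forall>u. f u \<noteq> -\<infinity>) \<and> dom_ereal f \<noteq> {}"

definition epi :: "('a \<Rightarrow> ereal) \<Rightarrow> ('a \<times> real) set" where
  "epi f = {(u, r). f u \<le> ereal r}"

definition closed_fun :: "('a::topological_space \<Rightarrow> ereal) \<Rightarrow> bool" where
  "closed_fun f \<longleftrightarrow> closed (epi f)"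

definition convex_fun :: "('a::real_vector \<Rightarrow> ereal) \<Rightarrow> bool" where
  "convex_fun f \<longleftrightarrow> convex (epi f)"

text \<open>
  Integral with values in the extended reals: integral of the positive part minus integral of the
  negative part (\<open>e2ennreal\<close> sends negative arguments to \<open>0\<close>). In \<^typ>\<open>ereal\<close> one has
  \<open>\<infinity> - \<infinity> = \<infinity>\<close>, but this case does not occur below: a proper convex function has an affine
  minorant, so the negative part of \<open>f \<circ> x\<close> has finite integral for \<open>x \<in> L1 \<tau>\<close>.
\<close>

definition ext_integral :: "'a measure \<Rightarrow> ('a \<Rightarrow> ereal) \<Rightarrow> ereal" where
  "ext_integral M g =
     enn2ereal (\<integral>\<^sup>+ s. e2ennreal (g s) \<partial>M) - enn2ereal (\<integral>\<^sup>+ s. e2ennreal (- g s) \<partial>M)"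

definition entropy :: "real \<Rightarrow> (real \<Rightarrow> ereal) \<Rightarrow> (real \<Rightarrow> real) \<Rightarrow> ereal" where
  "entropy \<tau> f x = ext_integral (lebesgue_on {0..\<tau>}) (\<lambda>s. f (x s))"

definition dom_entropy :: "real \<Rightarrow> (real \<Rightarrow> ereal) \<Rightarrow> (real \<Rightarrow> real) set" where
  "dom_entropy \<tau> f = {x \<in> L1 \<tau>. entropy \<tau> f x < \<infinity>}"

text \<open>The ambient \<open>L\<^sup>p\<close> space is taken with \<open>p = 1\<close>; the set is the same for every \<open>p\<close>.\<close>

definition S_set :: "real \<Rightarrow> real \<Rightarrow> real \<Rightarrow> (real \<Rightarrow> real) set" where
  "S_set \<tau> \<alpha> \<beta> = {x \<in> L1 \<tau>. AE s in lebesgue_on {0..\<tau>}. x s \<in> {\<alpha>..\<beta>}}"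

definition moment_op :: "real \<Rightarrow> ('n::finite \<Rightarrow> real \<Rightarrow> real) \<Rightarrow> (real \<Rightarrow> real) \<Rightarrow> real ^ 'n" where
  "moment_op \<tau> a x = (\<chi> i. integral\<^sup>L (lebesgue_on {0..\<tau>}) (\<lambda>s. a i s * x s))"

definition core :: "'a::real_vector set \<Rightarrow> 'a set" where
  "core C = {c \<in> C. \<forall>\<eta>. \<forall>\<^sub>F t in at_right (0::real). c + t *\<^sub>R \<eta> \<in> C}"

end

theory Submission
  imports Defs
begin

text \<open>
  The conclusion is a surjectivity statement: it is enough to move the moments of \<open>x\<close> in every
  direction \<open>\<eta>\<close> by a bounded perturbation \<open>h\<close> supported on the interval \<open>Z = {\<zeta>1..\<zeta>2}\<close>, where \<open>x\<close>
  stays at positive distance from both endpoints of \<open>{\<alpha>..\<beta>}\<close>. For small \<open>t > 0\<close> the function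
  \<open>x + t h\<close> then still takes almost all its values in \<open>{\<alpha>..\<beta>}\<close>. A convex function that is finite at
  \<open>\<alpha>\<close> and \<open>\<beta>\<close> is bounded above between them, so such a function has entropy less than \<open>\<infinity>\<close>
  (\<open>S_set_subset_dom_entropy\<close>), and by linearity its moments are \<open>b + t \<eta>\<close>.

  The perturbation is sought in the span of the moment functions themselves,
  \<open>h = indicator Z * (\<Sum>j. c j * a j)\<close>. Its moments are \<open>G c\<close>, where \<open>G\<close> is the Gram matrix of the
  \<open>a i\<close> in \<open>L\<^sup>2(Z)\<close>. Linear independence makes \<open>G\<close> positive definite, so \<open>G c = \<eta>\<close> can be solved
  for every \<open>\<eta>\<close> (\<open>Gram_solvable\<close>), and boundedness of the \<open>a i\<close> makes \<open>h\<close> bounded.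
\<close>

lemma integrable_mult_AE_bounded:
  fixes f g :: "'a \<Rightarrow> real"
  assumes "f \<in> borel_measurable M" "AE s in M. \<bar>f s\<bar> \<le> B" "integrable M g"
  shows "integrable M (\<lambda>s. f s * g s)"
proof (rule Bochner_Integration.integrable_bound)
  show "integrable M (\<lambda>s. B * g s)"
    using assms(3) by simp
  show "(\<lambda>s. f s * g s) \<in> borel_measurable M"
    using assms(1) borel_measurable_integrable[OF assms(3)] by measurable
  show "AE s in M. norm (f s * g s) \<le> norm (B * g s)"
    using assms(2)
  proof eventually_elim
    case (elim s)
    then have "\<bar>f s\<bar> \<le> \<bar>B\<bar>" by linarith
    then show ?case
      by (simp add: abs_mult mult_right_mono)
  qed
qed

lemma AE_bounded_sum:
  fixes a :: "'i \<Rightarrow> 'a \<Rightarrow> real"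
  assumes "finite I" "\<And>i. i \<in> I \<Longrightarrow> \<exists>B. AE s in M. \<bar>a i s\<bar> \<le> B"
  shows "\<exists>B. AE s in M. \<bar>\<Sum>i\<in>I. c i * a i s\<bar> \<le> B"
proof -
  obtain B where B: "\<And>i. i \<in> I \<Longrightarrow> AE s in M. \<bar>a i s\<bar> \<le> B i"
    using assms(2) by metis
  have "AE s in M. \<forall>i\<in>I. \<bar>a i s\<bar> \<le> B i"
    using assms(1) B by (simp add: AE_finite_all)
  then have "AE s in M. \<bar>\<Sum>i\<in>I. c i * a i s\<bar> \<le> (\<Sum>i\<in>I. \<bar>c i\<bar> * B i)"
  proof eventually_elim
    case (elim s)
    have "\<bar>\<Sum>i\<in>I. c i * a i s\<bar> \<le> (\<Sum>i\<in>I. \<bar>c i * a i s\<bar>)"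
      by (rule sum_abs)
    also have "\<dots> \<le> (\<Sum>i\<in>I. \<bar>c i\<bar> * B i)"
      using elim by (intro sum_mono) (simp add: abs_mult mult_left_mono)
    finally show ?case .
  qed
  then show ?thesis by blast
qed

text \<open>
  If the Gram map \<open>G\<close> kills \<open>c\<close>, then \<open>0 = c \<bullet> G c\<close> is the squared \<open>L\<^sup>2\<close> norm of
  \<open>\<Sum>j. c j * a j\<close>, so that function vanishes almost everywhere and \<open>c = 0\<close>. Hence \<open>G\<close> is an
  injective endomorphism of a finite-dimensional space, and so it is surjective.
\<close>

lemma Gram_solvable:
  fixes a :: "'n::finite \<Rightarrow> 'a \<Rightarrow> real" and \<eta> :: "real ^ 'n"
  assumes "finite_measure M"
    and meas: "\<And>i. a i \<in> borel_measurable M"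
    and bdd: "\<And>i. \<exists>B. AE s in M. \<bar>a i s\<bar> \<le> B"
    and indep: "\<And>c. (AE s in M. (\<Sum>i\<in>UNIV. c i * a i s) = 0) \<Longrightarrow> \<forall>i. c i = 0"
  shows "\<exists>c :: real ^ 'n. \<forall>i. (\<integral>s. a i s * (\<Sum>j\<in>UNIV. c $ j * a j s) \<partial>M) = \<eta> $ i"
proof -
  interpret finite_measure M by fact
  have int1: "integrable M (a j)" for j
    using bdd[of j] meas[of j] integrable_const_bound[of "a j"] by auto
  have int2: "integrable M (\<lambda>s. a i s * a j s)" for i j
    using bdd[of i] meas[of i] int1[of j] by (auto intro: integrable_mult_AE_bounded)
  define g where "g = (\<lambda>(c :: real ^ 'n) s. \<Sum>j\<in>UNIV. c $ j * a j s)"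
  define G :: "real ^ 'n ^ 'n" where "G = (\<chi> i j. \<integral>s. a i s * a j s \<partial>M)"
  have prod_eq: "a i s * g c s = (\<Sum>j\<in>UNIV. c $ j * (a i s * a j s))" for i c s
    unfolding g_def sum_distrib_left by (intro sum.cong) auto
  have int_ag: "integrable M (\<lambda>s. a i s * g c s)" for i c
    unfolding prod_eq by (intro Bochner_Integration.integrable_sum integrable_mult_right int2)
  have G: "(G *v c) $ i = (\<integral>s. a i s * g c s \<partial>M)" for c i
    unfolding prod_eq
    by (subst Bochner_Integration.integral_sum)
       (auto simp: G_def matrix_vector_mult_def int2 mult.commute)
  have square_eq: "(g c s)\<^sup>2 = (\<Sum>i\<in>UNIV. c $ i * (a i s * g c s))" for c s
    unfolding power2_eq_square
    by (subst (1) g_def) (simp add: sum_distrib_right mult.assoc)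
  have int_square: "integrable M (\<lambda>s. (g c s)\<^sup>2)" for c
    unfolding square_eq by (intro Bochner_Integration.integrable_sum integrable_mult_right int_ag)
  have quadratic_form: "c \<bullet> (G *v c) = (\<integral>s. (g c s)\<^sup>2 \<partial>M)" for c
    unfolding square_eq
    by (subst Bochner_Integration.integral_sum) (auto simp: inner_vec_def G int_ag)
  have "c = 0" if "G *v c = 0" for c
  proof -
    have "(\<integral>s. (g c s)\<^sup>2 \<partial>M) = 0"
      using quadratic_form[of c] that by simp
    then have "AE s in M. (g c s)\<^sup>2 = 0"
      using integral_nonneg_eq_0_iff_AE[OF int_square[of c]] by simp
    then have "AE s in M. (\<Sum>i\<in>UNIV. c $ i * a i s) = 0"
      by (simp add: g_def)
    then show ?thesis
      using indep[of "\<lambda>i. c $ i"] by (simp add: vec_eq_iff)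
  qed
  then have "inj ((*v) G)"
    by (simp add: linear_injective_0)
  then have "surj ((*v) G)"
    by (intro linear_injective_imp_surjective) auto
  then obtain c where "G *v c = \<eta>"
    by (metis surjD)
  then have "(\<integral>s. a i s * g c s \<partial>M) = \<eta> $ i" for i
    using G[of c i] by simp
  then show ?thesis
    unfolding g_def by (intro exI allI)
qed

text \<open>
  The point \<open>(u, r)\<close> lies on the horizontal chord of the epigraph between \<open>(\<alpha>, r)\<close> and \<open>(\<beta>, r)\<close>.
\<close>

lemma convex_fun_bounded_between:
  fixes f :: "real \<Rightarrow> ereal"
  assumes "convex_fun f" "f \<alpha> \<le> ereal r" "f \<beta> \<le> ereal r" "u \<in> {\<alpha>..\<beta>}"
  shows "f u \<le> ereal r"
proof -
  obtain t where t: "0 \<le> t" "t \<le> 1" "u = (1 - t) *\<^sub>R \<alpha> + t *\<^sub>R \<beta>"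
    using assms(4) by (metis atLeastAtMost_iff closed_segment_eq_real_ivl1 in_segment(1) order_trans)
  have "(1 - t) *\<^sub>R (\<alpha>, r) + t *\<^sub>R (\<beta>, r) \<in> epi f"
    using assms t by (intro convexD_alt) (auto simp: convex_fun_def epi_def)
  also have "(1 - t) *\<^sub>R (\<alpha>, r) + t *\<^sub>R (\<beta>, r) = (u, r)"
    by (simp add: t(3) algebra_simps)
  finally show ?thesis
    by (simp add: epi_def)
qed

text \<open>
  The upper bound on \<open>f\<close> over \<open>{\<alpha>..\<beta>}\<close> makes the integral of the positive part of \<open>f \<circ> y\<close> finite,
  and subtracting the integral of the negative part can only lower the value.
\<close>

lemma S_set_subset_dom_entropy:
  assumes "convex_fun f" "\<alpha> \<in> dom_ereal f" "\<beta> \<in> dom_ereal f"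
  shows "S_set \<tau> \<alpha> \<beta> \<subseteq> dom_entropy \<tau> f"
proof
  fix y assume y: "y \<in> S_set \<tau> \<alpha> \<beta>"
  let ?M = "lebesgue_on {0..\<tau>}"
  have "max (f \<alpha>) (f \<beta>) < \<infinity>"
    using assms by (simp add: dom_ereal_def max_def)
  then obtain r where "max (f \<alpha>) (f \<beta>) \<le> ereal r"
    by (metis less_ereal.simps(4) ereal_dense2 less_imp_le)
  then have r: "f \<alpha> \<le> ereal r" "f \<beta> \<le> ereal r"
    by auto
  have "AE s in ?M. y s \<in> {\<alpha>..\<beta>}"
    using y by (simp add: S_set_def)
  then have "AE s in ?M. e2ennreal (f (y s)) \<le> ennreal r"
  proof eventually_elim
    case (elim s)
    then have "f (y s) \<le> ereal r"
      using convex_fun_bounded_between[OF assms(1) r] by blast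
    then show ?case
      by (metis e2ennreal_mono e2ennreal_ereal)
  qed
  then have "(\<integral>\<^sup>+ s. e2ennreal (f (y s)) \<partial>?M) \<le> (\<integral>\<^sup>+ s. ennreal r \<partial>?M)"
    by (rule nn_integral_mono_AE)
  also have "\<dots> < \<infinity>"
    by (simp add: ennreal_mult_less_top emeasure_restrict_space emeasure_lborel_Icc_eq)
  finally have "enn2ereal (\<integral>\<^sup>+ s. e2ennreal (f (y s)) \<partial>?M) \<noteq> \<infinity>"
    by (metis enn2ereal_eq_top_iff infinity_ennreal_def less_irrefl top_ereal_def)
  moreover have "p - enn2ereal q \<noteq> \<infinity>" if "p \<noteq> \<infinity>" for p q
    using that enn2ereal_nonneg[of q] by (cases p; cases "enn2ereal q") auto
  ultimately have "entropy \<tau> f y \<noteq> \<infinity>"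
    unfolding entropy_def ext_integral_def by blast
  then show "y \<in> dom_entropy \<tau> f"
    using y by (simp add: dom_entropy_def S_set_def less_top)
qed

lemma moment_op_add_scale:
  assumes "\<And>i. a i \<in> Linf {0..\<tau>}" "x \<in> L1 \<tau>" "h \<in> L1 \<tau>"
  shows "moment_op \<tau> a (\<lambda>s. x s + t * h s) = moment_op \<tau> a x + t *\<^sub>R moment_op \<tau> a h"
proof -
  have int: "integrable (lebesgue_on {0..\<tau>}) (\<lambda>s. a i s * y s)" if "y \<in> L1 \<tau>" for i y
    using assms(1)[of i] that by (auto simp: Linf_def L1_def intro: integrable_mult_AE_bounded)
  show ?thesis
    using int[OF assms(2)] int[OF assms(3)]
    by (simp add: moment_op_def vec_eq_iff distrib_left mult.left_commute)
qed

text \<open>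
  Where \<open>h\<close> vanishes, the perturbed function agrees with \<open>x\<close>. Almost everywhere else \<open>x\<close> keeps at least the distance
  \<open>min (\<epsilon>1 - \<alpha>) (\<beta> - \<epsilon>2)\<close> from \<open>\<alpha>\<close> and \<open>\<beta>\<close>, which \<open>t h\<close> cannot exceed for small \<open>t\<close>.
\<close>

lemma eventually_perturbation_in_S_set:
  assumes "x \<in> S_set \<tau> \<alpha> \<beta>" "h \<in> L1 \<tau>"
    and bdd: "AE s in lebesgue_on {0..\<tau>}. \<bar>h s\<bar> \<le> B"
    and inner: "AE s in lebesgue_on {0..\<tau>}. h s \<noteq> 0 \<longrightarrow> x s \<in> {\<epsilon>1..\<epsilon>2}"
    and "\<alpha> < \<epsilon>1" "\<epsilon>2 < \<beta>"
  shows "\<forall>\<^sub>F t in at_right 0. (\<lambda>s. x s + t * h s) \<in> S_set \<tau> \<alpha> \<beta>"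
proof -
  define \<delta> where "\<delta> = min (\<epsilon>1 - \<alpha>) (\<beta> - \<epsilon>2)"
  have "((\<lambda>t. t * B) \<longlongrightarrow> 0 * B) (at_right 0)"
    by (intro tendsto_intros)
  moreover have "0 * B < \<delta>"
    using assms(5,6) by (simp add: \<delta>_def)
  ultimately have "\<forall>\<^sub>F t in at_right 0. t * B < \<delta>"
    by (rule order_tendstoD(2))
  then show ?thesis
    using eventually_at_right_less[of "0::real"]
  proof eventually_elim
    case (elim t)
    have xS: "AE s in lebesgue_on {0..\<tau>}. x s \<in> {\<alpha>..\<beta>}"
      using assms(1) by (simp add: S_set_def)
    have "AE s in lebesgue_on {0..\<tau>}. x s + t * h s \<in> {\<alpha>..\<beta>}"
      using xS bdd inner
    proof eventually_elim
      fix s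
      assume s: "x s \<in> {\<alpha>..\<beta>}" "\<bar>h s\<bar> \<le> B" "h s \<noteq> 0 \<longrightarrow> x s \<in> {\<epsilon>1..\<epsilon>2}"
      have "\<bar>t * h s\<bar> \<le> t * B"
        using s(2) elim(2) by (simp add: abs_mult)
      then have "\<bar>t * h s\<bar> < \<delta>"
        using elim(1) by simp
      then show "x s + t * h s \<in> {\<alpha>..\<beta>}"
        using s(1,3) by (cases "h s = 0") (auto simp: \<delta>_def)
    qed
    then show ?case
      using assms(1,2) by (simp add: S_set_def L1_def)
  qed
qed

theorem theorem3p3:
  fixes \<tau> \<alpha> \<beta> \<zeta>1 \<zeta>2 \<epsilon>1 \<epsilon>2 :: real
    and f :: "real \<Rightarrow> ereal"
    and a :: "'n::finite \<Rightarrow> real \<Rightarrow> real"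
    and b :: "real ^ 'n"
    and x :: "real \<Rightarrow> real"
  assumes "\<tau> > 0"
    and "proper_fun f" and "closed_fun f" and "convex_fun f"
    and "\<alpha> < \<beta>" and "{\<alpha>..\<beta>} \<subseteq> dom_ereal f"
    and "\<And>i. a i \<in> Linf {0..\<tau>}"
    and "x \<in> S_set \<tau> \<alpha> \<beta>" and "moment_op \<tau> a x = b"
    and "0 \<le> \<zeta>1" and "\<zeta>1 < \<zeta>2" and "\<zeta>2 \<le> \<tau>"
    and "\<epsilon>1 \<le> \<epsilon>2" and "{\<epsilon>1..\<epsilon>2} \<subseteq> {\<alpha><..<\<beta>}"
    and "AE s in lebesgue_on {\<zeta>1..\<zeta>2}. x s \<in> {\<epsilon>1..\<epsilon>2}"
    and "\<And>i. a i \<in> Linf {\<zeta>1..\<zeta>2}"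
    and "lin_indep_Linf {\<zeta>1..\<zeta>2} a"
  shows "b \<in> core (moment_op \<tau> a ` dom_entropy \<tau> f)"
proof -
  define Z where "Z = {\<zeta>1..\<zeta>2}"
  let ?M = "lebesgue_on {0..\<tau>}" and ?N = "lebesgue_on Z"
  note S_dom = S_set_subset_dom_entropy[OF \<open>convex_fun f\<close>, of \<alpha> \<beta> \<tau>]
  have ends: "\<alpha> \<in> dom_ereal f" "\<beta> \<in> dom_ereal f" "\<alpha> < \<epsilon>1" "\<epsilon>2 < \<beta>"
    using assms(5,6,13,14) by auto
  have ZT: "Z \<subseteq> {0..\<tau>}"
    using assms(10,12) by (auto simp: Z_def)
  have N_eq: "?N = restrict_space ?M Z"
    using assms(10,12) by (simp add: Z_def restrict_restrict_space max_absorb2 min_absorb2)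
  have Z_sets: "Z \<inter> space ?M \<in> sets ?M"
    using ZT by (auto simp: Z_def sets_restrict_space)
  have finN: "finite_measure ?N"
    by (auto simp: Z_def intro!: finite_measureI
        simp: emeasure_restrict_space space_restrict_space
          emeasure_lborel_Icc_eq)
  have meas: "\<And>i. a i \<in> borel_measurable ?N" and bdd: "\<And>i. \<exists>B. AE s in ?N. \<bar>a i s\<bar> \<le> B"
    using assms(16) by (auto simp: Linf_def Z_def[symmetric])
  have indep: "\<And>c. (AE s in ?N. (\<Sum>i\<in>UNIV. c i * a i s) = 0) \<Longrightarrow> \<forall>i. c i = 0"
    using assms(17) by (simp add: lin_indep_Linf_def Z_def[symmetric])
  have "\<forall>\<^sub>F t in at_right 0. b + t *\<^sub>R \<eta> \<in> moment_op \<tau> a ` dom_entropy \<tau> f" for \<eta>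
  proof -
    obtain c :: "real ^ 'n" where
      c: "\<forall>i. (\<integral>s. a i s * (\<Sum>j\<in>UNIV. c $ j * a j s) \<partial>?N) = \<eta> $ i"
      using Gram_solvable[where a = a, OF finN meas bdd indep] by blast
    define g where "g = (\<lambda>s. \<Sum>j\<in>UNIV. c $ j * a j s)"
    define h where "h = (\<lambda>s. indicator Z s *\<^sub>R g s)"
    obtain B where B: "AE s in ?N. \<bar>g s\<bar> \<le> B"
      using AE_bounded_sum[where a = a and M = ?N and c = "\<lambda>j. c $ j", OF finite bdd]
      by (auto simp: g_def)
    have "g \<in> borel_measurable ?N"
      unfolding g_def using meas by measurable
    then have "integrable ?N g"
      by (rule finite_measure.integrable_const_bound[OF finN, where B = B, rotated])
        (use B in simp)
    then have h_L1: "h \<in> L1 \<tau>"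
      unfolding L1_def h_def mem_Collect_eq N_eq integrable_restrict_space[OF Z_sets] .
    have h_bdd: "AE s in ?M. \<bar>h s\<bar> \<le> \<bar>B\<bar>"
      using B unfolding N_eq AE_restrict_space_iff[OF Z_sets]
      by eventually_elim (auto simp: h_def indicator_def)
    have h_supp: "AE s in ?M. h s \<noteq> 0 \<longrightarrow> x s \<in> {\<epsilon>1..\<epsilon>2}"
      using assms(15) unfolding Z_def[symmetric] N_eq AE_restrict_space_iff[OF Z_sets]
      by eventually_elim (auto simp: h_def indicator_def)
    have "(\<integral>s. a i s * h s \<partial>?M) = \<eta> $ i" for i
    proof -
      have "(\<integral>s. a i s * h s \<partial>?M) = (\<integral>s. a i s * g s \<partial>?N)"
        unfolding N_eq integral_restrict_space[OF Z_sets]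
        by (simp only: h_def mult_scaleR_right)
      then show ?thesis
        using c unfolding g_def by simp
    qed
    then have h_moment: "moment_op \<tau> a h = \<eta>"
      by (simp add: moment_op_def vec_eq_iff)
    have x_L1: "x \<in> L1 \<tau>"
      using assms(8) by (simp add: S_set_def)
    show ?thesis
      using eventually_perturbation_in_S_set[OF assms(8) h_L1 h_bdd h_supp ends(3,4)]
    proof eventually_elim
      case (elim t)
      have "moment_op \<tau> a (\<lambda>s. x s + t * h s) = b + t *\<^sub>R \<eta>"
        using moment_op_add_scale[where a = a, OF assms(7) x_L1 h_L1] h_moment assms(9) by simp
      then show ?case
        using S_dom[OF ends(1,2)] elim by (intro image_eqI[where x = "\<lambda>s. x s + t * h s"]) auto
    qed
  qed
  moreover have "b \<in> moment_op \<tau> a ` dom_entropy \<tau> f"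
    using assms(8,9) S_dom ends(1,2) by blast
  ultimately show ?thesis
    by (simp add: core_def)
qed

end
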